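(* Let $G=(V,E)$ be a connected simple undirected graph (not necessarily finite) satisfying the following condition: (WC) For every edge $uv$ of $G$, the subgraph of $G$ induced by $W_=(u,v)$ has at most two connected components; and, writing $W'_=(u,v)$ and $W''_=(u,v)$ for (the vertex sets of) these components (one or both of which are allowed to be empty), each of the two pairs $$\mathcal W'_{uv}:=\{\,W(u,v)\cup W'_=(u,v),\; W(v,u)\cup W''_=(u,v)\,\},$$ $$\mathcal W''_{uv}:=\{\,W(u,v)\cup W''_=(u,v),\; W(v,u)\cup W'_=(u,v)\,\}$$ consists of complementary convex subsets of $G$. Then $G$ satisfies the positioning condition (PC): for any vertex $b$ of $G$ and any square $u_1u_2u_3u_4$ of $G$, $$d_G(b,u_1)+d_G(b,u_3)=d_G(b,u_2)+d_G(b,u_4).$$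
   Context: $d_G(u,v)$ is the length of a shortest $(u,v)$-path in $G$. The interval between $u$ and $v$ is $I(u,v)=\{x\in V: d_G(u,x)+d_G(x,v)=d_G(u,v)\}$. A set $A\subseteq V$ is convex if $I(x,y)\subseteq A$ for all $x,y\in A$. For an edge $uv$ of $G$: $W(u,v)=\{x\in V: d_G(x,u)<d_G(x,v)\}$, $W(v,u)=\{x\in V: d_G(x,v)<d_G(x,u)\}$, and $W_=(u,v)=\{x\in V: d_G(x,u)=d_G(x,v)\}$. If $W_=(u,v)$ induces a connected nonempty subgraph, then one of $W'_=(u,v),W''_=(u,v)$ is $W_=(u,v)$ and the other is empty; if $W_=(u,v)=\emptyset$, both are empty. A square $u_1u_2u_3u_4$ of $G$ is an induced 4-cycle: $u_1u_2,u_2u_3,u_3u_4,u_4u_1$ are edges, while $u_1,u_3$ are distinct and non-adjacent, and $u_2,u_4$ are distinct and non-adjacent. *)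

theory Defs
  imports Main
begin

text \<open>Graphs with an arbitrary (possibly infinite) vertex set; edges are two-element sets of
  vertices, so simple graphs have neither loops nor multiple edges.\<close>

record 'a graph =
  verts :: "'a set"
  edges :: "'a set set"

definition simple_graph :: "'a graph \<Rightarrow> bool" where
  "simple_graph G \<longleftrightarrow>
     (\<forall>e \<in> edges G. \<exists>u v. e = {u, v} \<and> u \<noteq> v \<and> u \<in> verts G \<and> v \<in> verts G)"

definition is_path :: "'a graph \<Rightarrow> 'a \<Rightarrow> 'a \<Rightarrow> 'a list \<Rightarrow> bool" where
  "is_path G u v p \<longleftrightarrow>
     p \<noteq> [] \<and> hd p = u \<and> last p = v \<and> distinct p \<and> set p \<subseteq> verts G \<and>
     successively (\<lambda>x y. {x, y} \<in> edges G) p"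

definition connected_graph :: "'a graph \<Rightarrow> bool" where
  "connected_graph G \<longleftrightarrow> (\<forall>u \<in> verts G. \<forall>v \<in> verts G. \<exists>p. is_path G u v p)"

text \<open>The length of a path is its number of edges. The value is meaningful only if some path
  from \<open>u\<close> to \<open>v\<close> exists.\<close>

definition gdist :: "'a graph \<Rightarrow> 'a \<Rightarrow> 'a \<Rightarrow> nat" where
  "gdist G u v = (LEAST n. \<exists>p. is_path G u v p \<and> length p = n + 1)"

definition ginterval :: "'a graph \<Rightarrow> 'a \<Rightarrow> 'a \<Rightarrow> 'a set" where
  "ginterval G u v = {x \<in> verts G. gdist G u x + gdist G x v = gdist G u v}"

definition gconvex :: "'a graph \<Rightarrow> 'a set \<Rightarrow> bool" where
  "gconvex G A \<longleftrightarrow> A \<subseteq> verts G \<and> (\<forall>x \<in> A. \<forall>y \<in> A. ginterval G x y \<subseteq> A)"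

definition induced_subgraph :: "'a graph \<Rightarrow> 'a set \<Rightarrow> 'a graph" where
  "induced_subgraph G A = \<lparr>verts = A, edges = {e \<in> edges G. e \<subseteq> A}\<rparr>"

definition component_sets :: "'a graph \<Rightarrow> 'a set set" where
  "component_sets G = {{y \<in> verts G. \<exists>p. is_path G x y p} | x. x \<in> verts G}"

definition W :: "'a graph \<Rightarrow> 'a \<Rightarrow> 'a \<Rightarrow> 'a set" where
  "W G u v = {x \<in> verts G. gdist G x u < gdist G x v}"

definition W_eq :: "'a graph \<Rightarrow> 'a \<Rightarrow> 'a \<Rightarrow> 'a set" where
  "W_eq G u v = {x \<in> verts G. gdist G x u = gdist G x v}"

text \<open>\<open>A\<close> and \<open>B\<close> list the components of \<open>H\<close>, padded by empty sets if \<open>H\<close> has fewer than two.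
  Disjointness excludes listing a single component twice.\<close>

definition component_pair :: "'a graph \<Rightarrow> 'a set \<Rightarrow> 'a set \<Rightarrow> bool" where
  "component_pair H A B \<longleftrightarrow> component_sets H = {A, B} - {{}} \<and> A \<inter> B = {}"

definition complementary_convex :: "'a graph \<Rightarrow> 'a set \<Rightarrow> 'a set \<Rightarrow> bool" where
  "complementary_convex G A B \<longleftrightarrow>
     gconvex G A \<and> gconvex G B \<and> A \<union> B = verts G \<and> A \<inter> B = {}"

definition WC :: "'a graph \<Rightarrow> bool" where
  "WC G \<longleftrightarrow>
     (\<forall>u v. {u, v} \<in> edges G \<longrightarrow>
        (let H = induced_subgraph G (W_eq G u v) in
           finite (component_sets H) \<and> card (component_sets H) \<le> 2 \<and>
           (\<forall>W' W''. component_pair H W' W'' \<longrightarrow>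
              complementary_convex G (W G u v \<union> W') (W G v u \<union> W'') \<and>
              complementary_convex G (W G u v \<union> W'') (W G v u \<union> W'))))"

definition is_square :: "'a graph \<Rightarrow> 'a \<Rightarrow> 'a \<Rightarrow> 'a \<Rightarrow> 'a \<Rightarrow> bool" where
  "is_square G u1 u2 u3 u4 \<longleftrightarrow>
     {u1, u2} \<in> edges G \<and> {u2, u3} \<in> edges G \<and> {u3, u4} \<in> edges G \<and> {u4, u1} \<in> edges G \<and>
     u1 \<noteq> u3 \<and> {u1, u3} \<notin> edges G \<and> u2 \<noteq> u4 \<and> {u2, u4} \<notin> edges G"

definition PC :: "'a graph \<Rightarrow> bool" where
  "PC G \<longleftrightarrow>
     (\<forall>b \<in> verts G. \<forall>u1 u2 u3 u4. is_square G u1 u2 u3 u4 \<longrightarrow>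
        gdist G b u1 + gdist G b u3 = gdist G b u2 + gdist G b u4)"

end

theory Submission imports Defs begin

text \<open>
  For an edge \<open>uv\<close>, condition (WC) makes \<open>W(v,u)\<close> together with either component of
  \<open>W\<^sub>=(u,v)\<close> convex, so every vertex \<open>b\<close> that is not strictly closer to \<open>u\<close> lies in a convex set
  that contains \<open>W(v,u)\<close> and misses \<open>W(u,v)\<close> (\<open>convex_separation\<close>).
  If now \<open>xy\<close> is another edge with \<open>x \<in> W(u,v)\<close> and \<open>y \<in> W(v,u)\<close>, then \<open>x\<close> cannot lie on
  a shortest path from \<open>b\<close> to \<open>y\<close>, and hence \<open>b\<close> is not strictly closer to \<open>x\<close> than to \<open>y\<close>
  (\<open>crossing_edge_orientation\<close>).

  Opposite edges of a square cross each other in this sense, in both directions. So for the edges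
  \<open>u\<^sub>1u\<^sub>2\<close> and \<open>u\<^sub>4u\<^sub>3\<close> the signs of \<open>d(b,u\<^sub>1) - d(b,u\<^sub>2)\<close> and \<open>d(b,u\<^sub>4) - d(b,u\<^sub>3)\<close> agree. The
  distances from \<open>b\<close> to adjacent vertices differ by at most one, so the differences themselves
  agree, which is the positioning condition.
\<close>

section \<open>Paths and distances\<close>

lemma is_path_rev:
  assumes "is_path G u v p"
  shows "is_path G v u (rev p)"
proof -
  have "successively (\<lambda>x y. {x, y} \<in> edges G) (rev p)"
    using assms unfolding successively_rev is_path_def by (simp add: insert_commute)
  then show ?thesis
    using assms by (simp add: is_path_def hd_rev last_rev)
qed

lemma is_path_extend:
  assumes p: "is_path G u v p" and e: "{v, w} \<in> edges G" and w: "w \<in> verts G"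
  shows "\<exists>q. is_path G u w q \<and> length q \<le> Suc (length p)"
proof (cases "w \<in> set p")
  case True
  \<comment> \<open>Paths have no repeated vertices, so here the path must be cut at \<open>w\<close>.\<close>
  then obtain p1 p2 where "p = (p1 @ [w]) @ p2"
    by (metis append.assoc append_Cons append_Nil split_list)
  then have "is_path G u w (p1 @ [w])" "length (p1 @ [w]) \<le> Suc (length p)"
    using p by (auto simp: is_path_def successively_append_iff hd_append split: if_splits)
  then show ?thesis by blast
next
  case False
  then have "is_path G u w (p @ [w])"
    using p e w by (auto simp: is_path_def successively_append_iff)
  then show ?thesis by force
qed

lemma is_path_trans:
  assumes p: "is_path G u v p" and q: "is_path G v w q"
  shows "\<exists>r. is_path G u w r"
proof -
  have "\<exists>r. is_path G u (last q) r"
    if "q \<noteq> []" "hd q = v" "set q \<subseteq> verts G" "successively (\<lambda>x y. {x, y} \<in> edges G) q" for q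
    using that
  proof (induction q rule: rev_induct)
    case (snoc z q)
    show ?case
    proof (cases "q = []")
      case True
      with snoc.prems p show ?thesis by auto
    next
      case False
      with snoc obtain r where "is_path G u (last q) r"
        by (auto simp: successively_append_iff)
      moreover from False snoc.prems have "{last q, z} \<in> edges G" "z \<in> verts G"
        by (auto simp: successively_append_iff)
      ultimately show ?thesis using is_path_extend by fastforce
    qed
  qed simp
  with q show ?thesis by (auto simp: is_path_def)
qed

lemma gdist_le:
  assumes "is_path G u v p"
  shows "gdist G u v \<le> length p - 1"
  unfolding gdist_def
proof (rule Least_le, intro exI conjI)
  show "is_path G u v p" by (rule assms)
  show "length p = length p - 1 + 1"
    using assms by (cases p) (auto simp: is_path_def)
qed

lemma gdist_witness:
  assumes "connected_graph G" "u \<in> verts G" "v \<in> verts G"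
  obtains p where "is_path G u v p" "length p = gdist G u v + 1"
proof -
  from assms obtain p where p: "is_path G u v p"
    by (auto simp: connected_graph_def)
  then have "length p = (length p - 1) + 1"
    by (cases p) (auto simp: is_path_def)
  with p have "\<exists>n. \<exists>p. is_path G u v p \<and> length p = n + 1" by blast
  from LeastI_ex[OF this] that show ?thesis
    unfolding gdist_def by blast
qed


lemma edge_vertsD:
  assumes "simple_graph G" "{u, v} \<in> edges G"
  shows "u \<in> verts G" "v \<in> verts G" "u \<noteq> v"
proof -
  from assms obtain a b where "{u, v} = {a, b}" "a \<noteq> b" "a \<in> verts G" "b \<in> verts G"
    unfolding simple_graph_def by blast
  then show "u \<in> verts G" "v \<in> verts G" "u \<noteq> v"
    by (auto simp: doubleton_eq_iff)
qed

lemma gdist_edge_le: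
  assumes "simple_graph G" "connected_graph G" "b \<in> verts G" "{u, v} \<in> edges G"
  shows "gdist G b v \<le> gdist G b u + 1"
proof -
  note e = edge_vertsD[OF assms(1,4)]
  obtain p where p: "is_path G b u p" "length p = gdist G b u + 1"
    using gdist_witness[OF assms(2,3) e(1)] .
  from is_path_extend[OF p(1) assms(4) e(2)] obtain q
    where "is_path G b v q" "length q \<le> Suc (length p)" by blast
  with gdist_le[of G b v q] p(2) show ?thesis by linarith
qed

lemma gdist_eq_0D:
  assumes "connected_graph G" "u \<in> verts G" "v \<in> verts G" "gdist G u v = 0"
  shows "u = v"
proof -
  obtain p where "is_path G u v p" "length p = 1"
    using gdist_witness[OF assms(1-3)] assms(4) by auto
  then show ?thesis by (cases p) (auto simp: is_path_def)
qed

lemma gdist_eq_1D: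
  assumes "connected_graph G" "u \<in> verts G" "v \<in> verts G" "gdist G u v = 1"
  shows "{u, v} \<in> edges G"
proof -
  obtain p where p: "is_path G u v p" "length p = gdist G u v + 1"
    using gdist_witness[OF assms(1-3)] .
  then have "length p = Suc (Suc 0)" using assms(4) by simp
  then obtain x y where "p = [x, y]" unfolding length_Suc_conv by blast
  with p show ?thesis by (auto simp: is_path_def)
qed

lemma gdist_edge:
  assumes "simple_graph G" "connected_graph G" "{u, v} \<in> edges G"
  shows "gdist G u v = 1"
proof -
  note e = edge_vertsD[OF assms(1,3)]
  have "is_path G u v [u, v]" using assms(3) e by (auto simp: is_path_def)
  from gdist_le[OF this] have "gdist G u v \<le> 1" by simp
  moreover have "gdist G u v \<noteq> 0"
    using gdist_eq_0D[OF assms(2) e(1,2)] e(3) by blast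
  ultimately show ?thesis by simp
qed

section \<open>Components\<close>

lemma component_sets_disjoint:
  assumes "A \<in> component_sets H" "B \<in> component_sets H" "A \<noteq> B"
  shows "A \<inter> B = {}"
proof (rule ccontr)
  assume "A \<inter> B \<noteq> {}"
  then obtain z where z: "z \<in> A" "z \<in> B" by blast
  from assms obtain a b where
    A: "A = {y \<in> verts H. \<exists>p. is_path H a y p}" and
    B: "B = {y \<in> verts H. \<exists>p. is_path H b y p}"
    by (auto simp: component_sets_def)
  from z A B obtain p q where pq: "is_path H a z p" "is_path H b z q" by blast
  obtain r where r: "is_path H a b r"
    using is_path_trans[OF pq(1) is_path_rev[OF pq(2)]] by blast
  have "(\<exists>p. is_path H a y p) \<longleftrightarrow> (\<exists>p. is_path H b y p)" for y
    using is_path_trans[OF r] is_path_trans[OF is_path_rev[OF r]] by blast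
  with A B assms(3) show False by simp
qed

lemma Union_component_sets: "\<Union> (component_sets H) = verts H"
proof
  show "\<Union> (component_sets H) \<subseteq> verts H" by (auto simp: component_sets_def)
  show "verts H \<subseteq> \<Union> (component_sets H)"
  proof
    fix x assume "x \<in> verts H"
    moreover from this have "is_path H x x [x]" by (simp add: is_path_def)
    ultimately show "x \<in> \<Union> (component_sets H)" unfolding component_sets_def by blast
  qed
qed

lemma empty_notin_component_sets: "{} \<notin> component_sets H"
proof
  assume "{} \<in> component_sets H"
  then obtain x where "x \<in> verts H" and no_path: "{y \<in> verts H. \<exists>p. is_path H x y p} = {}"
    by (auto simp: component_sets_def)
  then have "is_path H x x [x]" by (simp add: is_path_def)
  with \<open>x \<in> verts H\<close> no_path show False by blast
qed

lemma component_pair_exists: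
  assumes "finite (component_sets H)" "card (component_sets H) \<le> 2"
  obtains A B where "component_pair H A B" "A \<union> B = verts H"
proof -
  have "card (component_sets H) = 0 \<or> card (component_sets H) = 1 \<or> card (component_sets H) = 2"
    using assms(2) by linarith
  then have "\<exists>A B. component_pair H A B"
  proof (elim disjE)
    assume "card (component_sets H) = 0"
    with assms(1) have "component_pair H {} {}" by (simp add: component_pair_def)
    then show ?thesis by blast
  next
    assume "card (component_sets H) = 1"
    then obtain A where "component_sets H = {A}" by (auto simp: card_1_singleton_iff)
    with empty_notin_component_sets[of H] have "component_pair H A {}"
      by (auto simp: component_pair_def)
    then show ?thesis by blast
  next
    assume "card (component_sets H) = 2"
    then obtain A B where AB: "component_sets H = {A, B}" "A \<noteq> B" by (auto simp: card_2_iff)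
    with empty_notin_component_sets[of H] component_sets_disjoint[of A H B]
    have "component_pair H A B" by (auto simp: component_pair_def)
    then show ?thesis by blast
  qed
  then obtain A B where AB: "component_pair H A B" by blast
  then have "A \<union> B = \<Union> (component_sets H)" by (auto simp: component_pair_def)
  with AB that Union_component_sets show ?thesis by metis
qed

section \<open>Separation by convex sets\<close>

text \<open>The two pairs in (WC) allow attaching either component of \<open>W\<^sub>=(u,v)\<close> to \<open>W(v,u)\<close>, so one
  can choose the component that contains \<open>b\<close>, if \<open>b\<close> is equidistant from \<open>u\<close> and \<open>v\<close>.\<close>

lemma convex_separation:
  assumes "WC G" "{u, v} \<in> edges G" "b \<in> verts G" "gdist G b v \<le> gdist G b u"
  obtains S where "gconvex G S" "b \<in> S" "W G v u \<subseteq> S" "S \<inter> W G u v = {}"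
proof -
  define H where "H = induced_subgraph G (W_eq G u v)"
  have wc: "finite (component_sets H)" "card (component_sets H) \<le> 2"
    "\<And>A B. component_pair H A B \<Longrightarrow>
       complementary_convex G (W G u v \<union> A) (W G v u \<union> B) \<and>
       complementary_convex G (W G u v \<union> B) (W G v u \<union> A)"
    using assms(1,2) unfolding WC_def Let_def H_def by blast+
  obtain A B where AB: "component_pair H A B" "A \<union> B = verts H"
    using component_pair_exists[OF wc(1,2)] .
  have "b \<in> W G v u \<union> W_eq G u v"
    using assms(3,4) by (auto simp: W_def W_eq_def)
  moreover have "verts H = W_eq G u v" by (simp add: H_def induced_subgraph_def)
  ultimately have "b \<in> W G v u \<union> A \<or> b \<in> W G v u \<union> B" using AB(2) by blast
  then obtain C D where C: "b \<in> W G v u \<union> C"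
    and "complementary_convex G (W G u v \<union> D) (W G v u \<union> C)"
    using wc(3)[OF AB(1)] by blast
  then have "gconvex G (W G v u \<union> C)" "(W G v u \<union> C) \<inter> W G u v = {}"
    unfolding complementary_convex_def by blast+
  with C that show ?thesis by blast
qed

text \<open>Otherwise \<open>x\<close> would be the last vertex before \<open>y\<close> on a shortest path from \<open>b\<close> to \<open>y\<close>, and
  this path would leave a convex set that contains both of its ends.\<close>

lemma crossing_edge_orientation:
  assumes "simple_graph G" "connected_graph G" "WC G"
    and "{u, v} \<in> edges G" "{x, y} \<in> edges G" "x \<in> W G u v" "y \<in> W G v u"
    and "b \<in> verts G" "gdist G b v \<le> gdist G b u"
  shows "gdist G b y \<le> gdist G b x"
proof (rule ccontr)
  assume "\<not> gdist G b y \<le> gdist G b x"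
  with gdist_edge_le[OF assms(1,2,8,5)] gdist_edge[OF assms(1,2,5)]
  have "gdist G b x + gdist G x y = gdist G b y" by linarith
  with edge_vertsD[OF assms(1,5)] have "x \<in> ginterval G b y" by (simp add: ginterval_def)
  moreover obtain S where "gconvex G S" "b \<in> S" "W G v u \<subseteq> S" "S \<inter> W G u v = {}"
    using convex_separation[OF assms(3,4,8,9)] .
  ultimately show False using assms(6,7) unfolding gconvex_def by blast
qed

section \<open>Squares\<close>

lemma nonadjacent_in_W:
  assumes "simple_graph G" "connected_graph G"
    and "{x, u} \<in> edges G" "v \<in> verts G" "x \<noteq> v" "{x, v} \<notin> edges G"
  shows "x \<in> W G u v"
proof -
  note e = edge_vertsD[OF assms(1,3)]
  have "gdist G x v \<noteq> 0" "gdist G x v \<noteq> 1"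
    using gdist_eq_0D[OF assms(2) e(1) assms(4)] gdist_eq_1D[OF assms(2) e(1) assms(4)] assms(5,6)
    by blast+
  with gdist_edge[OF assms(1-3)] e(1) show ?thesis by (simp add: W_def)
qed

lemma square_orientation:
  assumes "simple_graph G" "connected_graph G" "WC G" "b \<in> verts G"
    and sq: "is_square G u1 u2 u3 u4" and "gdist G b u2 \<le> gdist G b u1"
  shows "gdist G b u3 \<le> gdist G b u4"
proof -
  have e: "{u1, u2} \<in> edges G" "{u3, u2} \<in> edges G" "{u4, u3} \<in> edges G" "{u4, u1} \<in> edges G"
    using sq by (auto simp: is_square_def insert_commute)
  note v = edge_vertsD[OF assms(1) e(1)]
  have "u4 \<in> W G u1 u2"
    by (rule nonadjacent_in_W[OF assms(1,2) e(4) v(2)])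
      (use sq in \<open>auto simp: is_square_def insert_commute\<close>)
  moreover have "u3 \<in> W G u2 u1"
    by (rule nonadjacent_in_W[OF assms(1,2) e(2) v(1)])
      (use sq in \<open>auto simp: is_square_def insert_commute\<close>)
  ultimately show ?thesis
    using crossing_edge_orientation[OF assms(1-3) e(1) e(3) _ _ assms(4,6)] by blast
qed

theorem mainTheorem3:
  fixes G :: "'a graph"
  assumes "simple_graph G"
    and "connected_graph G"
    and "WC G"
  shows "PC G"
  unfolding PC_def
proof (intro ballI allI impI)
  fix b u1 u2 u3 u4
  assume b: "b \<in> verts G" and sq: "is_square G u1 u2 u3 u4"
  have e: "{u1, u2} \<in> edges G" "{u2, u1} \<in> edges G" "{u3, u4} \<in> edges G" "{u4, u3} \<in> edges G"
    using sq by (auto simp: is_square_def insert_commute)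
  \<comment> \<open>The symmetries of the square that preserve the pair of opposite edges \<open>u\<^sub>1u\<^sub>2\<close>, \<open>u\<^sub>4u\<^sub>3\<close>.\<close>
  have "is_square G u2 u1 u4 u3" "is_square G u4 u3 u2 u1" "is_square G u3 u4 u1 u2"
    using sq by (auto simp: is_square_def insert_commute)
  note orientation = sq this
  have "gdist G b u2 \<le> gdist G b u1 \<longleftrightarrow> gdist G b u3 \<le> gdist G b u4"
    "gdist G b u1 \<le> gdist G b u2 \<longleftrightarrow> gdist G b u4 \<le> gdist G b u3"
    using orientation[THEN square_orientation[OF assms b]] by blast+
  with gdist_edge_le[OF assms(1,2) b e(1)] gdist_edge_le[OF assms(1,2) b e(2)]
    gdist_edge_le[OF assms(1,2) b e(3)] gdist_edge_le[OF assms(1,2) b e(4)]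
  show "gdist G b u1 + gdist G b u3 = gdist G b u2 + gdist G b u4"
    by linarith
qed

end
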